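(* Let $T>0$ and $\overline{\Delta}_T=\{(s,t):0\le s\le t\le T\}$. Let $(X,\|\cdot\|_X)$ and $(Y,\|\cdot\|_Y)$ be Banach spaces such that $X\subseteq Y$ is a linear subspace which is dense with respect to $\|\cdot\|_Y$, and $\|x\|_Y\le\|x\|_X$ for all $x\in X$. Let $\mu:\overline{\Delta}_T\to L(X,X)\cap L(Y,Y)$, that is, $\mu_{s,t}\in L(Y,Y)$, $\mu_{s,t}$ maps $X$ into $X$, and $\mu_{s,t}|_X$ is continuous with respect to $\|\cdot\|_X$. Assume: (a) $\mu_{s,s}=\mathrm{Id}$ for all $s\in[0,T]$; (b) there exist continuous functions $\epsilon_1,\epsilon_2:\overline{\Delta}_T\to[0,\infty)$, increasing in the second argument and decreasing in the first argument, such that for any $s\le t$ in $[0,T]$ and any partition $\pi=\{s=t_0<t_1<\dots<t_k=t\}$ of $[s,t]$, $$\|\mu^\pi_{s,t}\|_{L(X,X)}\le\epsilon_1(s,t),\qquad \|\mu^\pi_{s,t}\|_{L(Y,Y)}\le\epsilon_2(s,t),\qquad\text{where } \mu^\pi_{s,t}:=\mu_{s,t_1}\mu_{t_1,t_2}\cdots\mu_{t_{k-1},t};$$ (c) there exist a control $\chi$ and $z>1$ such that for all $s\le u\le t$ in $[0,T]$, $$\|\mu_{s,t}-\mu_{s,u}\mu_{u,t}\|_{L(X,Y)}\le\chi(s,t)^z .$$ Then there exists a unique evolution system of bounded linear operators $(\psi_{s,t})_{0\le s\le t\le T}$ on $Y$ such that for all $s\le t$ in $[0,T]$ and any sequence $(\pi_n)_n$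 of partitions of $[s,t]$ with mesh $|\pi_n|\to0$, $$\|\psi_{s,t}-\mu^{\pi_n}_{s,t}\|_{L(X,Y)}\to0 .$$ Furthermore, $\|\psi_{s,t}\|_{L(Y,Y)}\le\epsilon_2(s,t)$, $$\|\psi_{s,t}-\mu_{s,t}\|_{L(X,Y)}\le2^z\zeta(z)\,\epsilon_1(s,t)\,\epsilon_2(s,t)\,\chi(s,t)^z,$$ and, for every partition $\pi=\{s=t_0<t_1<\dots<t_k=t\}$ of $[s,t]$, $$\|\mu^\pi_{s,t}-\psi_{s,t}\|_{L(X,Y)}\le2^z\,\epsilon_1(s,t)^2\,\epsilon_2(s,t)^2\,\zeta(z)\,\chi(s,t)\max_{0\le i\le k-1}\chi(t_i,t_{i+1})^{z-1},$$ where $\zeta$ is the Riemann zeta function. If in addition $(\mu_{s,t})$ is strongly continuous in $L(Y,Y)$ in the sense that for all $y\in Y$, $\|\mu_{s,t}y-y\|_Y\to0$ as $t-s\to0$, then $(\psi_{s,t})$ is also strongly continuous in the same sense, i.e. $\|\psi_{s,t}y-y\|_Y\to0$ as $t-s\to0$ for all $y\in Y$.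
   Context: $L(E,F)$ denotes the space of bounded linear operators from $E$ to $F$ with the operator norm. For an operator $A\in L(Y,Y)$, $\|A\|_{L(X,Y)}$ is the norm of its restriction to $X$ as an operator $(X,\|\cdot\|_X)\to(Y,\|\cdot\|_Y)$, and $\|A\|_{L(X,X)}$ (if $A$ maps $X$ boundedly into $X$) the norm of its restriction as an operator on $(X,\|\cdot\|_X)$. A control is a continuous map $\chi:\overline{\Delta}_T\to[0,\infty)$ with $\chi(s,u)+\chi(u,t)\le\chi(s,t)$ for all $s\le u\le t$ in $[0,T]$ and $\chi(s,s)=0$ for all $s\in[0,T]$. An evolution system on a Banach space $\mathbb{B}$ is a family $(\psi_{s,t})_{0\le s\le t\le T}$ of bounded linear operators on $\mathbb{B}$ with $\psi_{s,s}=\mathrm{Id}$ and $\psi_{s,t}=\psi_{s,u}\psi_{u,t}$ for $0\le s\le u\le t\le T$. The mesh of $\pi=\{s=t_0<\dots<t_k=t\}$ is $|\pi|=\max_i|t_{i+1}-t_i|$. For $s=t$ the only partition is trivial and $\mu^{\pi}_{s,s}=\mathrm{Id}$. *)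

theory Defs
  imports "HOL-Analysis.Analysis"
begin

definition time_simplex :: "real \<Rightarrow> (real \<times> real) set" where
  "time_simplex T = {(s, t). 0 \<le> s \<and> s \<le> t \<and> t \<le> T}"

text \<open>
  The inclusion of a subspace \<open>X \<subseteq> Y\<close> carrying its own Banach norm is represented by an injective
  bounded linear map \<open>j\<close> from a Banach space \<open>'x\<close> into a Banach space \<open>'y\<close>, so that
  \<open>X\<close> is identified with \<open>range j\<close>, normed by \<open>\<parallel>j x\<parallel>\<^sub>X = \<parallel>x\<parallel>\<close>.
\<close>

definition banach_inclusion :: "('x::banach \<Rightarrow>\<^sub>L 'y::banach) \<Rightarrow> bool" where
  "banach_inclusion j \<longleftrightarrow>
     inj (blinfun_apply j) \<and>
     closure (range (blinfun_apply j)) = UNIV \<and>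
     (\<forall>x. norm (blinfun_apply j x) \<le> norm x)"

text \<open>
  An operator on \<open>Y\<close> belongs to \<open>L(X,X) \<inter> L(Y,Y)\<close> if it maps \<open>X\<close> into \<open>X\<close> and its
  restriction is bounded for the norm of \<open>X\<close>.
\<close>

definition preserves :: "('x::banach \<Rightarrow>\<^sub>L 'y::banach) \<Rightarrow> ('y \<Rightarrow>\<^sub>L 'y) \<Rightarrow> bool" where
  "preserves j A \<longleftrightarrow>
     (\<exists>B :: 'x \<Rightarrow>\<^sub>L 'x. \<forall>x. blinfun_apply j (blinfun_apply B x) = blinfun_apply A (blinfun_apply j x))"

definition restrict_op :: "('x::banach \<Rightarrow>\<^sub>L 'y::banach) \<Rightarrow> ('y \<Rightarrow>\<^sub>L 'y) \<Rightarrow> ('x \<Rightarrow>\<^sub>L 'x)" where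
  "restrict_op j A =
     (THE B. \<forall>x. blinfun_apply j (blinfun_apply B x) = blinfun_apply A (blinfun_apply j x))"

lemma restrict_op_apply:
  assumes "inj (blinfun_apply j)" and "preserves j A"
  shows "blinfun_apply j (blinfun_apply (restrict_op j A) x) = blinfun_apply A (blinfun_apply j x)"
proof -
  obtain B where B: "\<forall>x. blinfun_apply j (blinfun_apply B x) = blinfun_apply A (blinfun_apply j x)"
    using assms(2) unfolding preserves_def by blast
  have "\<forall>x. blinfun_apply j (blinfun_apply (restrict_op j A) x) = blinfun_apply A (blinfun_apply j x)"
    unfolding restrict_op_def
  proof (rule theI, rule B)
    fix C assume C: "\<forall>x. blinfun_apply j (blinfun_apply C x) = blinfun_apply A (blinfun_apply j x)"
    show "C = B"
    proof (rule blinfun_eqI)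
      fix x show "blinfun_apply C x = blinfun_apply B x"
        using B C assms(1) by (metis injD)
    qed
  qed
  then show ?thesis by blast
qed

text \<open>The norms \<open>\<parallel>A\<parallel>\<close> in \<open>L(X,X)\<close> (meaningful when \<open>A\<close> preserves \<open>X\<close>) and in \<open>L(X,Y)\<close>.\<close>

definition norm_XX :: "('x::banach \<Rightarrow>\<^sub>L 'y::banach) \<Rightarrow> ('y \<Rightarrow>\<^sub>L 'y) \<Rightarrow> real" where
  "norm_XX j A = norm (restrict_op j A)"

definition norm_XY :: "('x::banach \<Rightarrow>\<^sub>L 'y::banach) \<Rightarrow> ('y \<Rightarrow>\<^sub>L 'y) \<Rightarrow> real" where
  "norm_XY j A = norm (A o\<^sub>L j)"

text \<open>
  A partition \<open>s = t\<^sub>0 < \<dots> < t\<^sub>k = t\<close> is the strictly increasing list of its points; for \<open>s = t\<close>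
  the only one is \<open>[s]\<close>.
\<close>

definition is_partition :: "real \<Rightarrow> real \<Rightarrow> real list \<Rightarrow> bool" where
  "is_partition s t p \<longleftrightarrow> p \<noteq> [] \<and> sorted_wrt (<) p \<and> hd p = s \<and> last p = t"

text \<open>
  The maximum of \<open>f t\<^sub>i t\<^sub>i\<^sub>+\<^sub>1\<close> over the intervals of a partition. Inserting \<open>0\<close> changes nothing for
  the nonnegative \<open>f\<close> it is used with, and gives \<open>0\<close> for the trivial partition.
\<close>

definition partition_Max :: "(real \<Rightarrow> real \<Rightarrow> real) \<Rightarrow> real list \<Rightarrow> real" where
  "partition_Max f p = Max (insert 0 ((\<lambda>i. f (p ! i) (p ! Suc i)) ` {i. Suc i < length p}))"

definition mesh :: "real list \<Rightarrow> real" where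
  "mesh p = partition_Max (\<lambda>a b. \<bar>b - a\<bar>) p"

fun partition_prod ::
  "(real \<Rightarrow> real \<Rightarrow> ('y::real_normed_vector \<Rightarrow>\<^sub>L 'y)) \<Rightarrow> real list \<Rightarrow> ('y \<Rightarrow>\<^sub>L 'y)" where
  "partition_prod \<mu> (a # b # p) = \<mu> a b o\<^sub>L partition_prod \<mu> (b # p)"
| "partition_prod \<mu> _ = id_blinfun"

definition monotone_bound :: "real \<Rightarrow> (real \<Rightarrow> real \<Rightarrow> real) \<Rightarrow> bool" where
  "monotone_bound T \<epsilon> \<longleftrightarrow>
     continuous_on (time_simplex T) (\<lambda>(s, t). \<epsilon> s t) \<and>
     (\<forall>(s, t) \<in> time_simplex T. 0 \<le> \<epsilon> s t) \<and>
     (\<forall>s t t'. 0 \<le> s \<and> s \<le> t \<and> t \<le> t' \<and> t' \<le> T \<longrightarrow> \<epsilon> s t \<le> \<epsilon> s t') \<and>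
     (\<forall>s s' t. 0 \<le> s \<and> s \<le> s' \<and> s' \<le> t \<and> t \<le> T \<longrightarrow> \<epsilon> s' t \<le> \<epsilon> s t)"

definition control :: "real \<Rightarrow> (real \<Rightarrow> real \<Rightarrow> real) \<Rightarrow> bool" where
  "control T chi \<longleftrightarrow>
     continuous_on (time_simplex T) (\<lambda>(s, t). chi s t) \<and>
     (\<forall>(s, t) \<in> time_simplex T. 0 \<le> chi s t) \<and>
     (\<forall>s u t. 0 \<le> s \<and> s \<le> u \<and> u \<le> t \<and> t \<le> T \<longrightarrow> chi s u + chi u t \<le> chi s t) \<and>
     (\<forall>s. 0 \<le> s \<and> s \<le> T \<longrightarrow> chi s s = 0)"

definition evolution_system ::
  "real \<Rightarrow> (real \<Rightarrow> real \<Rightarrow> ('y::real_normed_vector \<Rightarrow>\<^sub>L 'y)) \<Rightarrow> bool" where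
  "evolution_system T \<psi> \<longleftrightarrow>
     (\<forall>s. 0 \<le> s \<and> s \<le> T \<longrightarrow> \<psi> s s = id_blinfun) \<and>
     (\<forall>s u t. 0 \<le> s \<and> s \<le> u \<and> u \<le> t \<and> t \<le> T \<longrightarrow> \<psi> s t = \<psi> s u o\<^sub>L \<psi> u t)"

definition partition_limit ::
  "('x::banach \<Rightarrow>\<^sub>L 'y::banach) \<Rightarrow> real \<Rightarrow> (real \<Rightarrow> real \<Rightarrow> ('y \<Rightarrow>\<^sub>L 'y)) \<Rightarrow>
    (real \<Rightarrow> real \<Rightarrow> ('y \<Rightarrow>\<^sub>L 'y)) \<Rightarrow> bool" where
  "partition_limit j T \<mu> \<psi> \<longleftrightarrow>
     (\<forall>s t \<pi>. 0 \<le> s \<and> s \<le> t \<and> t \<le> T \<and> (\<forall>n :: nat. is_partition s t (\<pi> n)) \<and>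
        (\<lambda>n. mesh (\<pi> n)) \<longlonglongrightarrow> 0 \<longrightarrow>
        (\<lambda>n. norm_XY j (\<psi> s t - partition_prod \<mu> (\<pi> n))) \<longlonglongrightarrow> 0)"

definition strongly_continuous ::
  "real \<Rightarrow> (real \<Rightarrow> real \<Rightarrow> ('y::real_normed_vector \<Rightarrow>\<^sub>L 'y)) \<Rightarrow> bool" where
  "strongly_continuous T \<mu> \<longleftrightarrow>
     (\<forall>y. \<forall>e>0. \<exists>d>0. \<forall>(s, t) \<in> time_simplex T.
        t - s < d \<longrightarrow> norm (blinfun_apply (\<mu> s t) y - y) < e)"

text \<open>The Riemann zeta function on the real half-line \<open>z > 1\<close>, where its Dirichlet series converges.\<close>

definition zeta :: "real \<Rightarrow> real" where
  "zeta z = (\<Sum>n. 1 / real (Suc n) powr z)"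

end

theory Submission
  imports Defs
begin

text \<open>
  Removing from a partition of \<open>[s, t]\<close> with \<open>N + 1\<close> intervals a point whose two adjacent intervals carry at most
  the average control changes the product by at most a multiple of \<open>(2 * chi s t / N) powr z\<close>. Summing over
  successive removals bounds the distance from any partition product to \<open>\<mu> s t\<close>, and applying
  this on each interval of a coarse partition bounds its distance to any refinement. Hence the
  products form a Cauchy family in \<open>L(X,Y)\<close>; being bounded in \<open>L(Y,Y)\<close>, they converge strongly
  on \<open>Y\<close> because \<open>X\<close> is dense.
\<close>

section \<open>Partitions\<close>

text \<open>The defect is controlled only as an operator from X to Y. In a product around it the
  factors on the right act first and must be bounded in L(X,X), those on the left in L(Y,Y); such a
  sandwich costs one factor \<open>\<epsilon>\<^sub>1 s t * \<epsilon>\<^sub>2 s t\<close>. Removing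
  all interior points costs this factor times the sum of \<open>1 / N powr z\<close> over the
  numbers N of interior points met on the way, which for z > 1 is bounded uniformly in the
  partition: this is the origin of \<open>2 powr z * zeta z\<close>. Comparing a partition with a
  refinement places these estimates, one for each interval, inside a second sandwich, hence the
  squares. There one factor \<open>chi\<close> of \<open>chi powr z\<close> is spent on
  superadditivity, so that the sum over the intervals stays below \<open>chi s t\<close>; the
  remaining power z - 1 > 0 becomes small with the mesh, since \<open>chi\<close> is uniformly
  continuous and vanishes on the diagonal. Two arbitrary partitions are compared through their
  common refinement.\<close>

lemma is_partition_Nil [simp]: "\<not> is_partition s t []"
  by (simp add: is_partition_def)

lemma is_partition_singleton [simp]: "is_partition s t [a] \<longleftrightarrow> a = s \<and> a = t"
  by (auto simp: is_partition_def)

lemma is_partition_Cons_Cons [simp]: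
  "is_partition s t (a # b # p) \<longleftrightarrow> a = s \<and> a < b \<and> is_partition b t (b # p)"
  by (auto simp: is_partition_def)

lemma is_partition_Cons_eq: "is_partition s t (a # p) \<Longrightarrow> a = s"
  by (simp add: is_partition_def)

lemma is_partition_le: "is_partition s t p \<Longrightarrow> s \<le> t"
proof (induction p arbitrary: s rule: induct_list012)
  case (3 a b p)
  from "3.IH"(2)[of b] "3.prems" show ?case by simp
qed auto

text \<open>The cut point ends the left piece and begins the right one. Products and maxima over
  intervals split at the same cut, so a partition can be taken apart at any of its points.\<close>

lemma is_partition_append_Cons:
  "is_partition s t (l @ b # r) \<longleftrightarrow> is_partition s b (l @ [b]) \<and> is_partition b t (b # r)"
proof (induction l arbitrary: s rule: induct_list012)
  case 1
  then show ?case by (auto simp: is_partition_def)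
qed auto

text \<open>The common refinement. Sorting a set leaves no repetitions, so the list is strictly
  increasing; \<open>s\<close> and \<open>t\<close> belong to it and bound the points of both
  partitions, so they are its ends.\<close>

lemma is_partition_sorted_list_of_set:
  assumes "is_partition s t p" "is_partition s t q"
  shows "is_partition s t (sorted_list_of_set (set p \<union> set q))" (is "is_partition s t ?r")
proof -
  have bounds: "s \<in> set p \<and> t \<in> set p \<and> (\<forall>x\<in>set p. s \<le> x \<and> x \<le> t)"
    if "is_partition s t p" for p
    using that
  proof (induction p arbitrary: s rule: induct_list012)
    case (3 a b p)
    then show ?case using "3.IH"(2)[of b] by fastforce
  qed auto
  have set_r: "set ?r = set p \<union> set q" by simp
  then have ne: "?r \<noteq> []" using bounds[OF assms(1)] by force
  have srt: "sorted ?r" by simp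
  have "hd ?r \<in> set ?r" "last ?r \<in> set ?r" by (rule hd_in_set[OF ne], rule last_in_set[OF ne])
  moreover have "hd xs \<le> x \<and> x \<le> last xs" if "sorted xs" "x \<in> set xs" for xs and x :: real
    using that by (induction xs) auto
  ultimately have "hd ?r = s" "last ?r = t"
    using bounds[OF assms(1)] bounds[OF assms(2)] set_r srt by (metis Un_iff antisym)+
  then show ?thesis
    unfolding is_partition_def using ne strict_sorted_list_of_set by blast
qed

lemma partition_Max_singleton [simp]: "partition_Max f [a] = 0"
  by (simp add: partition_Max_def)

text \<open>Index 0 is separated and the others are shifted, while the default 0 stays with the
  tail. This recursion lets the later inductions run over lists without indices.\<close>

lemma partition_Max_Cons_Cons:
  "partition_Max f (a # b # p) = max (f a b) (partition_Max f (b # p))"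
proof -
  have eq: "{i. Suc i < length (a # b # p)} = insert 0 (Suc ` {i. Suc i < length (b # p)})"
    by (auto simp: image_iff less_Suc_eq_0_disj)
  have "insert 0 ((\<lambda>i. f ((a # b # p) ! i) ((a # b # p) ! Suc i)) ` {i. Suc i < length (a # b # p)})
    = insert (f a b) (insert 0 ((\<lambda>i. f ((b # p) ! i) ((b # p) ! Suc i)) ` {i. Suc i < length (b # p)}))"
    unfolding eq by (auto simp: image_image)
  moreover have "finite {i. Suc i < length (b # p)}"
    by (rule finite_subset[of _ "{..length (b # p)}"]) auto
  ultimately show ?thesis
    unfolding partition_Max_def by (subst Max_insert[symmetric]) auto
qed

lemma partition_Max_nonneg: "0 \<le> partition_Max f p"
  unfolding partition_Max_def
  by (rule Max_ge) (auto intro!: finite_subset[of "{i. Suc i < length p}" "{..length p}"])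

lemma partition_Max_append_Cons:
  "partition_Max f (l @ b # r) = max (partition_Max f (l @ [b])) (partition_Max f (b # r))"
  \<comment> \<open>For empty \<open>l\<close> the left piece has maximum 0, which is absorbed
    because maxima are nonnegative.\<close>
  by (induction l rule: induct_list012)
    (auto simp: partition_Max_Cons_Cons max.assoc max_absorb2 partition_Max_nonneg)

lemma partition_prod_append_Cons:
  "partition_prod \<mu> (l @ b # r) = partition_prod \<mu> (l @ [b]) o\<^sub>L partition_prod \<mu> (b # r)"
  by (induction l rule: induct_list012) (auto intro!: blinfun_eqI)

text \<open>Induction on a number \<open>n\<close> of steps of length \<open>\<delta>\<close> that
  cover the interval; an interval longer than \<open>\<delta>\<close> loses one such step at its
  left end.\<close>

lemma exists_fine_partition:
  assumes "\<delta> > 0" "s \<le> t"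
  shows "\<exists>p. is_partition s t p \<and> mesh p \<le> \<delta>"
proof -
  have "\<exists>p. is_partition s t p \<and> mesh p \<le> \<delta>" if "s \<le> t" "t - s \<le> real n * \<delta>" for n s
    using that
  proof (induction n arbitrary: s)
    case 0
    then show ?case using assms by (intro exI[of _ "[s]"]) (auto simp: mesh_def)
  next
    case (Suc n)
    show ?case
    proof (cases "t - s \<le> \<delta>")
      case True
      then show ?thesis
        \<comment> \<open>For \<open>s = t\<close> the list \<open>[s, t]\<close> would not be
          strictly increasing.\<close>
        using Suc.prems assms
        by (intro exI[of _ "if s = t then [s] else [s, t]"])
          (auto simp: mesh_def partition_Max_Cons_Cons)
    next
      case False
      then have "t - (s + \<delta>) \<le> real n * \<delta>" "s + \<delta> \<le> t"
        using Suc.prems by (auto simp: algebra_simps)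
      then obtain p where p: "is_partition (s + \<delta>) t p" "mesh p \<le> \<delta>"
        using Suc.IH[of "s + \<delta>"] by blast
      then obtain p' where "p = (s + \<delta>) # p'"
        by (cases p) (auto dest: is_partition_Cons_eq)
      then show ?thesis
        using p assms by (intro exI[of _ "s # p"]) (auto simp: mesh_def partition_Max_Cons_Cons)
    qed
  qed
  moreover obtain n where "t - s \<le> real n * \<delta>"
    using reals_Archimedean3[OF assms(1)] by (auto intro: less_imp_le)
  ultimately show ?thesis using assms(2) by blast
qed

text \<open>Keeps the limit condition from being vacuous: it supplies the sequences along which
  limits are constructed and identified.\<close>

lemma exists_partition_sequence:
  assumes "s \<le> t"
  obtains \<pi> :: "nat \<Rightarrow> real list"
  where "\<And>n. is_partition s t (\<pi> n)" "(\<lambda>n. mesh (\<pi> n)) \<longlonglongrightarrow> 0"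
proof -
  have "\<forall>n. \<exists>p. is_partition s t p \<and> mesh p \<le> inverse (real (Suc n))"
    using exists_fine_partition[OF _ assms] by simp
  then obtain \<pi> where \<pi>: "\<And>n. is_partition s t (\<pi> n)" "\<And>n. mesh (\<pi> n) \<le> inverse (real (Suc n))"
    by metis
  have "(\<lambda>n. mesh (\<pi> n)) \<longlonglongrightarrow> 0"
    by (rule tendsto_sandwich[OF _ _ tendsto_const LIMSEQ_inverse_real_of_nat])
      (use \<pi>(2) in \<open>simp_all add: mesh_def partition_Max_nonneg\<close>)
  with \<pi>(1) show thesis by (rule that)
qed

section \<open>Operator norms\<close>

lemma norm_XY_nonneg [simp]: "0 \<le> norm_XY j A"
  by (simp add: norm_XY_def)

lemma norm_XY_zero [simp]: "norm_XY j 0 = 0"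
  by (simp add: norm_XY_def)

lemma norm_XY_triangle: "norm_XY j (A + B) \<le> norm_XY j A + norm_XY j B"
  by (simp add: norm_XY_def bounded_bilinear.add_left[OF bounded_bilinear_blinfun_compose] norm_triangle_ineq)

lemma norm_XY_minus_commute: "norm_XY j (A - B) = norm_XY j (B - A)"
  by (simp add: norm_XY_def bounded_bilinear.diff_left[OF bounded_bilinear_blinfun_compose] norm_minus_commute)

lemma norm_XY_diff_triangle: "norm_XY j (A - C) \<le> norm_XY j (A - B) + norm_XY j (B - C)"
  using norm_XY_triangle[of j "A - B" "B - C"] by simp

lemma norm_XY_apply: "norm (blinfun_apply A (blinfun_apply j x)) \<le> norm_XY j A * norm x"
  using norm_blinfun[of "A o\<^sub>L j" x] by (simp add: norm_XY_def)

lemma norm_XY_compose_left: "norm_XY j (A o\<^sub>L B) \<le> norm A * norm_XY j B"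
proof -
  have "(A o\<^sub>L B) o\<^sub>L j = A o\<^sub>L (B o\<^sub>L j)" by (rule blinfun_eqI) simp
  then show ?thesis
    using norm_blinfun_compose[of A "B o\<^sub>L j"] by (simp add: norm_XY_def)
qed

text \<open>The right factor acts first and keeps its argument in X, where \<open>A\<close> is
  measured; hence it enters through its norm on X and not through its norm on Y.\<close>

lemma norm_XY_compose_right:
  assumes "inj (blinfun_apply j)" "preserves j B"
  shows "norm_XY j (A o\<^sub>L B) \<le> norm_XY j A * norm_XX j B"
proof -
  have "(A o\<^sub>L B) o\<^sub>L j = (A o\<^sub>L j) o\<^sub>L restrict_op j B"
    by (rule blinfun_eqI) (simp add: restrict_op_apply[OF assms])
  then show ?thesis
    using norm_blinfun_compose[of "A o\<^sub>L j" "restrict_op j B"]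
    by (simp add: norm_XY_def norm_XX_def)
qed

lemma preserves_compose:
  assumes "preserves j A" "preserves j B"
  shows "preserves j (A o\<^sub>L B)"
proof -
  obtain A' B' where
    "\<forall>x. blinfun_apply j (blinfun_apply A' x) = blinfun_apply A (blinfun_apply j x)"
    "\<forall>x. blinfun_apply j (blinfun_apply B' x) = blinfun_apply B (blinfun_apply j x)"
    using assms unfolding preserves_def by blast
  then show ?thesis
    unfolding preserves_def by (intro exI[of _ "A' o\<^sub>L B'"]) simp
qed

lemma preserves_id: "preserves j id_blinfun"
  unfolding preserves_def by (intro exI[of _ id_blinfun]) simp

section \<open>Density of X: identification and convergence of operators on Y\<close>

lemma banach_inclusion_approx:
  assumes "banach_inclusion j" "e > 0"
  obtains x where "norm (y - blinfun_apply j x) < e"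
proof -
  have "y \<in> closure (range (blinfun_apply j))"
    using assms(1) by (simp add: banach_inclusion_def)
  then obtain w where "w \<in> range (blinfun_apply j)" "dist w y < e"
    using assms(2) unfolding closure_approachable by blast
  then show thesis
    using that by (auto simp: dist_norm norm_minus_commute)
qed

lemma blinfun_eq_on_banach_inclusion:
  assumes "banach_inclusion j"
    and "\<And>x. blinfun_apply A (blinfun_apply j x) = blinfun_apply B (blinfun_apply j x)"
  shows "A = B"
proof (rule blinfun_eqI)
  fix y
  have "closed {y. blinfun_apply A y = blinfun_apply B y}"
    by (intro closed_Collect_eq continuous_intros)
  then have "closure (range (blinfun_apply j)) \<subseteq> {y. blinfun_apply A y = blinfun_apply B y}"
    using assms(2) by (intro closure_minimal) auto
  then show "blinfun_apply A y = blinfun_apply B y"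
    using assms(1) by (auto simp: banach_inclusion_def)
qed

text \<open>By density \<open>norm_XY\<close> separates operators on all of Y, so limits in this
  norm are unique.\<close>

lemma eq_of_norm_XY_le_0:
  assumes "banach_inclusion j" "norm_XY j (A - B) \<le> 0"
  shows "A = B"
proof (rule blinfun_eq_on_banach_inclusion[OF assms(1)])
  fix x
  have "norm (blinfun_apply (A - B) (blinfun_apply j x)) \<le> 0"
    using norm_XY_apply[of "A - B" j x] assms(2) by (simp add: norm_XY_def)
  then show "blinfun_apply A (blinfun_apply j x) = blinfun_apply B (blinfun_apply j x)"
    by (simp add: blinfun.diff_left)
qed

text \<open>Equicontinuity: a uniform bound carries pointwise convergence from the dense subspace X
  over to Y.\<close>

lemma tendsto_blinfun_apply_of_norm_XY:
  assumes j: "banach_inclusion j"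
    and bd: "\<And>n. norm (A n) \<le> C"
    and lim: "(\<lambda>n. norm_XY j (L - A n)) \<longlonglongrightarrow> 0"
  shows "(\<lambda>n. blinfun_apply (A n) y) \<longlonglongrightarrow> blinfun_apply L y"
proof (rule LIMSEQ_I)
  fix e :: real assume "e > 0"
  \<comment> \<open>Bounds \<open>norm (A n - L)\<close>; the summand 1 makes it positive, so that
    it may be divided by.\<close>
  define K where "K = C + norm L + 1"
  have "0 \<le> C" using bd[of 0] norm_ge_zero[of "A 0"] by linarith
  then have K: "K > 0" unfolding K_def by (simp add: add_nonneg_pos)
  obtain x where x: "norm (y - blinfun_apply j x) < e / (2 * K)"
    using banach_inclusion_approx[OF j, of "e / (2 * K)"] \<open>e > 0\<close> K by auto
  have "(\<lambda>n. norm_XY j (L - A n) * norm x) \<longlonglongrightarrow> 0"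
    using tendsto_mult_left_zero[OF lim] .
  from LIMSEQ_D[OF this, of "e / 2"] obtain N where
    N: "\<And>n. n \<ge> N \<Longrightarrow> norm_XY j (L - A n) * norm x < e / 2"
    using \<open>e > 0\<close> by (auto simp: abs_mult)
  show "\<exists>N. \<forall>n\<ge>N. norm (blinfun_apply (A n) y - blinfun_apply L y) < e"
  proof (intro exI allI impI)
    fix n assume n: "N \<le> n"
    let ?d = "y - blinfun_apply j x"
    have "norm (blinfun_apply (A n) y - blinfun_apply L y)
        = norm (blinfun_apply (A n - L) ?d - blinfun_apply (L - A n) (blinfun_apply j x))"
      by (simp add: blinfun.bilinear_simps algebra_simps)
    also have "\<dots> \<le> norm (blinfun_apply (A n - L) ?d) + norm (blinfun_apply (L - A n) (blinfun_apply j x))"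
      by (rule norm_triangle_ineq4)
    also have "\<dots> \<le> K * norm ?d + norm_XY j (L - A n) * norm x"
    proof (rule add_mono)
      have "norm (A n - L) \<le> K"
        using norm_triangle_ineq4[of "A n" L] bd[of n] unfolding K_def by linarith
      then show "norm (blinfun_apply (A n - L) ?d) \<le> K * norm ?d"
        by (meson norm_blinfun mult_right_mono norm_ge_zero order_trans)
    qed (rule norm_XY_apply)
    also have "\<dots> < K * (e / (2 * K)) + e / 2"
      by (intro add_strict_mono mult_strict_left_mono x K N n)
    also have "\<dots> = e" using K by simp
    finally show "norm (blinfun_apply (A n) y - blinfun_apply L y) < e" .
  qed
qed

text \<open>A limit in L(X,Y) alone would not act on Y. Therefore the limit is taken pointwise on Y,
  where density and the uniform bound give Cauchy sequences, and the rate in \<open>norm_XY\<close>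
  is recovered afterwards.\<close>

lemma norm_XY_limit_exists:
  fixes j :: "'x::banach \<Rightarrow>\<^sub>L 'y::banach"
  assumes j: "banach_inclusion j"
    and bd: "\<And>n. norm (A n) \<le> C"
    and b: "b \<longlonglongrightarrow> (0::real)"
    and diff: "\<And>m n. norm_XY j (A m - A n) \<le> b m + b n"
  obtains L where "norm L \<le> C" "(\<lambda>n. norm_XY j (L - A n)) \<longlonglongrightarrow> 0"
proof -
  have C: "0 \<le> C" using bd[of 0] norm_ge_zero[of "A 0"] by linarith
  define K where "K = 2 * C + 1"
  have K: "K > 0" using C unfolding K_def by simp
  have small: "\<exists>M. \<forall>m\<ge>M. b m < e" if "e > 0" for e
    using LIMSEQ_D[OF b that] by fastforce
  have "Cauchy (\<lambda>n. blinfun_apply (A n) y)" for y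
  proof (rule metric_CauchyI)
    fix e :: real assume "e > 0"
    obtain x where x: "norm (y - blinfun_apply j x) < e / (2 * K)"
      using banach_inclusion_approx[OF j, of "e / (2 * K)"] \<open>e > 0\<close> K by auto
    \<comment> \<open>The factor \<open>b m + b n\<close> has two terms and is multiplied by
      \<open>norm x\<close>; the added 1 covers \<open>x = 0\<close>. Their product is then at most
      \<open>e / 2\<close>.\<close>
    obtain M where M: "\<And>m. m \<ge> M \<Longrightarrow> b m < e / (2 * (norm x + 1)) / 2"
      using small[of "e / (2 * (norm x + 1)) / 2"] \<open>e > 0\<close>
      by (auto simp: add_nonneg_pos)
    have "dist (blinfun_apply (A m) y) (blinfun_apply (A n) y) < e" if mn: "m \<ge> M" "n \<ge> M" for m n
    proof -
      let ?d = "y - blinfun_apply j x"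
      have "dist (blinfun_apply (A m) y) (blinfun_apply (A n) y)
        = norm (blinfun_apply (A m - A n) ?d + blinfun_apply (A m - A n) (blinfun_apply j x))"
        by (simp add: dist_norm blinfun.bilinear_simps)
      also have "\<dots> \<le> norm (blinfun_apply (A m - A n) ?d)
          + norm (blinfun_apply (A m - A n) (blinfun_apply j x))"
        by (rule norm_triangle_ineq)
      also have "\<dots> \<le> (K) * norm ?d + (b m + b n) * norm x"
      proof (rule add_mono)
        have "norm (A m - A n) \<le> K"
          using norm_triangle_ineq4[of "A m" "A n"] bd[of m] bd[of n] unfolding K_def by linarith
        then show "norm (blinfun_apply (A m - A n) ?d) \<le> (K) * norm ?d"
          by (meson norm_blinfun mult_right_mono norm_ge_zero order_trans)
        show "norm (blinfun_apply (A m - A n) (blinfun_apply j x)) \<le> (b m + b n) * norm x"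
          by (meson norm_XY_apply diff mult_right_mono norm_ge_zero order_trans)
      qed
      also have "\<dots> < (K) * (e / (2 * K)) + e / 2"
      proof (rule add_less_le_mono)
        show "(K) * norm ?d < (K) * (e / (2 * K))"
          using x K by (intro mult_strict_left_mono) auto
        have "b m + b n \<le> e / (2 * (norm x + 1)) / 2 + e / (2 * (norm x + 1)) / 2"
          using M[OF mn(1)] M[OF mn(2)] by linarith
        also have "\<dots> = e / (2 * (norm x + 1))"
          by (rule field_sum_of_halves)
        finally have "(b m + b n) * norm x \<le> e / (2 * (norm x + 1)) * norm x"
          by (rule mult_right_mono) simp
        also have "\<dots> = e / 2 * (norm x / (norm x + 1))"
          by simp
        also have "\<dots> \<le> e / 2 * 1"
          using \<open>e > 0\<close> by (intro mult_left_mono) (auto simp: divide_le_eq_1 add_nonneg_pos)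
        finally show "(b m + b n) * norm x \<le> e / 2" unfolding mult_1_right .
      qed
      also have "\<dots> = e" using K by (simp add: field_simps)
      finally show ?thesis .
    qed
    then show "\<exists>M. \<forall>m\<ge>M. \<forall>n\<ge>M. dist (blinfun_apply (A m) y) (blinfun_apply (A n) y) < e"
      by blast
  qed
  then have "convergent (\<lambda>n. blinfun_apply (A n) y)" for y
    by (rule Cauchy_convergent)
  then have "\<forall>y. \<exists>l. (\<lambda>n. blinfun_apply (A n) y) \<longlonglongrightarrow> l"
    by (simp add: convergent_def)
  from choice[OF this] obtain f where f: "\<And>y. (\<lambda>n. blinfun_apply (A n) y) \<longlonglongrightarrow> f y"
    by blast
  have f_norm: "norm (f y) \<le> norm y * C" for y
  proof (rule LIMSEQ_le_const2[OF tendsto_norm[OF f]])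
    show "\<exists>N. \<forall>n\<ge>N. norm (blinfun_apply (A n) y) \<le> norm y * C"
      by (metis norm_blinfun bd mult.commute mult_left_mono norm_ge_zero order_trans)
  qed
  have lin: "bounded_linear f"
  proof (rule bounded_linear_intro[where K = C])
    show "f (x + y) = f x + f y" for x y
      using LIMSEQ_unique[OF f[of "x + y"]] tendsto_add[OF f[of x] f[of y]]
      by (simp add: blinfun.bilinear_simps)
    show "f (r *\<^sub>R x) = r *\<^sub>R f x" for r x
      using LIMSEQ_unique[OF f[of "r *\<^sub>R x"]] tendsto_scaleR[OF tendsto_const f[of x], of r]
      by (simp add: blinfun.bilinear_simps)
  qed (rule f_norm)
  define L where "L = Blinfun f"
  have L: "blinfun_apply L = f" unfolding L_def by (rule bounded_linear_Blinfun_apply[OF lin])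
  have normL: "norm L \<le> C"
    by (rule norm_blinfun_bound[OF C]) (metis L f_norm mult.commute)
  have diffL: "norm_XY j (L - A n) \<le> b n" for n
  proof -
    \<comment> \<open>For equal indices the left side of \<open>diff\<close> is 0.\<close>
    have b0: "0 \<le> b n" using diff[of n n] by simp
    show ?thesis
      unfolding norm_XY_def
    proof (rule norm_blinfun_bound[OF b0])
      fix x
      \<comment> \<open>Letting \<open>m\<close> tend to infinity with \<open>n\<close> fixed
        replaces \<open>A m\<close> by \<open>L\<close> and removes \<open>b m\<close>.\<close>
      have "(\<lambda>m. norm (blinfun_apply (A m - A n) (blinfun_apply j x)))
          \<longlonglongrightarrow> norm (blinfun_apply (L - A n) (blinfun_apply j x))"
        unfolding blinfun.diff_left L by (intro tendsto_intros f)
      moreover have "(\<lambda>m. (b m + b n) * norm x) \<longlonglongrightarrow> (0 + b n) * norm x"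
        by (intro tendsto_intros b)
      moreover have "norm (blinfun_apply (A m - A n) (blinfun_apply j x)) \<le> (b m + b n) * norm x" for m
        by (meson norm_XY_apply diff mult_right_mono norm_ge_zero order_trans)
      ultimately show "norm (blinfun_apply ((L - A n) o\<^sub>L j) x) \<le> b n * norm x"
        using LIMSEQ_le[of _ _ "\<lambda>m. (b m + b n) * norm x" "b n * norm x"] by auto
    qed
  qed
  have "(\<lambda>n. norm_XY j (L - A n)) \<longlonglongrightarrow> 0"
    by (rule tendsto_sandwich[OF _ _ tendsto_const b]) (auto simp: diffL)
  with normL show thesis by (rule that)
qed

section \<open>Almost multiplicative families\<close>

locale almost_evolution =
  fixes T z :: real
    and j :: "'x::banach \<Rightarrow>\<^sub>L 'y::banach"
    and \<mu> :: "real \<Rightarrow> real \<Rightarrow> ('y \<Rightarrow>\<^sub>L 'y)"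
    and \<epsilon>\<^sub>1 \<epsilon>\<^sub>2 chi :: "real \<Rightarrow> real \<Rightarrow> real"
  assumes incl: "banach_inclusion j"
    and pres: "\<And>s t. 0 \<le> s \<Longrightarrow> s \<le> t \<Longrightarrow> t \<le> T \<Longrightarrow> preserves j (\<mu> s t)"
    and \<mu>_refl: "\<And>s. 0 \<le> s \<Longrightarrow> s \<le> T \<Longrightarrow> \<mu> s s = id_blinfun"
    and \<epsilon>\<^sub>1: "monotone_bound T \<epsilon>\<^sub>1" and \<epsilon>\<^sub>2: "monotone_bound T \<epsilon>\<^sub>2"
    and prod_XX: "\<And>s t p. 0 \<le> s \<Longrightarrow> s \<le> t \<Longrightarrow> t \<le> T \<Longrightarrow> is_partition s t p \<Longrightarrow>
           norm_XX j (partition_prod \<mu> p) \<le> \<epsilon>\<^sub>1 s t"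
    and prod_YY: "\<And>s t p. 0 \<le> s \<Longrightarrow> s \<le> t \<Longrightarrow> t \<le> T \<Longrightarrow> is_partition s t p \<Longrightarrow>
           norm (partition_prod \<mu> p) \<le> \<epsilon>\<^sub>2 s t"
    and ctrl: "control T chi" and z: "z > 1"
    and defect: "\<And>s u t. 0 \<le> s \<Longrightarrow> s \<le> u \<Longrightarrow> u \<le> t \<Longrightarrow> t \<le> T \<Longrightarrow>
           norm_XY j (\<mu> s t - (\<mu> s u o\<^sub>L \<mu> u t)) \<le> chi s t powr z"
begin

section \<open>Monotonicity and smallness of the control and the bounds\<close>

lemma j_inj: "inj (blinfun_apply j)"
  using incl by (simp add: banach_inclusion_def)

lemma chi_nonneg: "0 \<le> s \<Longrightarrow> s \<le> t \<Longrightarrow> t \<le> T \<Longrightarrow> 0 \<le> chi s t"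
  using ctrl unfolding control_def time_simplex_def by auto

lemma chi_superadditive:
  "0 \<le> s \<Longrightarrow> s \<le> u \<Longrightarrow> u \<le> t \<Longrightarrow> t \<le> T \<Longrightarrow> chi s u + chi u t \<le> chi s t"
  using ctrl unfolding control_def by blast

lemma chi_mono:
  assumes "0 \<le> s" "s \<le> s'" "s' \<le> t'" "t' \<le> t" "t \<le> T"
  shows "chi s' t' \<le> chi s t"
  using chi_superadditive[of s s' t] chi_superadditive[of s' t' t] chi_nonneg[of s s'] chi_nonneg[of t' t] assms
  by simp

lemma \<epsilon>_mono:
  assumes "0 \<le> s" "s \<le> s'" "s' \<le> t'" "t' \<le> t" "t \<le> T"
  shows "\<epsilon>\<^sub>1 s' t' \<le> \<epsilon>\<^sub>1 s t" "\<epsilon>\<^sub>2 s' t' \<le> \<epsilon>\<^sub>2 s t"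
proof -
  have "\<epsilon> s' t' \<le> \<epsilon> s t" if "monotone_bound T \<epsilon>" for \<epsilon>
  proof -
    have "\<epsilon> s' t' \<le> \<epsilon> s' t" "\<epsilon> s' t \<le> \<epsilon> s t"
      using that assms unfolding monotone_bound_def by auto
    then show ?thesis by (rule order_trans)
  qed
  then show "\<epsilon>\<^sub>1 s' t' \<le> \<epsilon>\<^sub>1 s t" "\<epsilon>\<^sub>2 s' t' \<le> \<epsilon>\<^sub>2 s t"
    using \<epsilon>\<^sub>1 \<epsilon>\<^sub>2 by blast+
qed

lemma \<epsilon>_nonneg:
  assumes "0 \<le> s" "s \<le> t" "t \<le> T"
  shows "0 \<le> \<epsilon>\<^sub>1 s t" "0 \<le> \<epsilon>\<^sub>2 s t"
  using assms \<epsilon>\<^sub>1 \<epsilon>\<^sub>2 unfolding monotone_bound_def time_simplex_def by auto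

text \<open>Uniform continuity on the compact simplex is applied to \<open>(s, t)\<close> and the
  diagonal point \<open>(s, s)\<close>, where the control is 0.\<close>

lemma chi_uniformly_small:
  assumes "e > 0"
  obtains d where "d > 0" "\<And>s t. 0 \<le> s \<Longrightarrow> s \<le> t \<Longrightarrow> t \<le> T \<Longrightarrow> t - s < d \<Longrightarrow> chi s t < e"
proof -
  have eq: "time_simplex T = ({0..T} \<times> {0..T}) \<inter> {x. fst x \<le> snd x}"
    by (auto simp: time_simplex_def)
  have "compact (time_simplex T)"
    unfolding eq by (intro compact_Int_closed compact_Times compact_Icc closed_Collect_le continuous_intros)
  then have "uniformly_continuous_on (time_simplex T) (\<lambda>(s, t). chi s t)"
    using ctrl unfolding control_def by (intro compact_uniformly_continuous) auto
  then obtain d where d: "d > 0"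
    "\<And>x y. x \<in> time_simplex T \<Longrightarrow> y \<in> time_simplex T \<Longrightarrow> dist y x < d \<Longrightarrow>
      dist (case y of (s, t) \<Rightarrow> chi s t) (case x of (s, t) \<Rightarrow> chi s t) < e"
    using assms unfolding uniformly_continuous_on_def by metis
  have "chi s t < e" if "0 \<le> s" "s \<le> t" "t \<le> T" "t - s < d" for s t
  proof -
    have "dist (s, t) (s, s) < d"
      using that by (simp add: dist_Pair_Pair dist_real_def)
    then have "dist (chi s t) (chi s s) < e"
      using d(2)[of "(s, s)" "(s, t)"] that by (simp add: time_simplex_def)
    moreover have "chi s s = 0" using ctrl that unfolding control_def by auto
    ultimately show ?thesis by (simp add: dist_real_def)
  qed
  with d(1) show thesis by (rule that)
qed

section \<open>Estimates for an operator between two partition products\<close>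

lemma preserves_partition_prod:
  assumes "0 \<le> s" "t \<le> T" "is_partition s t p"
  shows "preserves j (partition_prod \<mu> p)"
  using assms
proof (induction p arbitrary: s rule: induct_list012)
  case (3 a b p)
  then have "is_partition b t (b # p)" "0 \<le> b" "a \<le> b" "0 \<le> a" by auto
  moreover from this(1) have "b \<le> t" by (rule is_partition_le)
  ultimately show ?case
    using "3.IH"(2)[of b] "3.prems"(2) by (auto intro!: preserves_compose pres)
qed (auto simp: preserves_id)

text \<open>The two products are bounded on their own intervals, then monotonicity enlarges both
  bounds to \<open>[s, t]\<close>, so the constant does not depend on the position of
  \<open>D\<close>. The gap between \<open>u\<close> and \<open>v\<close> is the interval on which
  two products differ.\<close>

lemma sandwich_bound:
  assumes "0 \<le> s" "t \<le> T" "is_partition s u p" "u \<le> v" "is_partition v t q"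
  shows "norm_XY j (partition_prod \<mu> p o\<^sub>L D o\<^sub>L partition_prod \<mu> q) \<le> \<epsilon>\<^sub>1 s t * \<epsilon>\<^sub>2 s t * norm_XY j D"
proof -
  have le: "s \<le> u" "v \<le> t" using assms is_partition_le by auto
  have "norm_XY j (partition_prod \<mu> p o\<^sub>L D o\<^sub>L partition_prod \<mu> q)
      \<le> norm_XY j (partition_prod \<mu> p o\<^sub>L D) * norm_XX j (partition_prod \<mu> q)"
    using assms le by (intro norm_XY_compose_right[OF j_inj] preserves_partition_prod[of v t]) auto
  also have "\<dots> \<le> (norm (partition_prod \<mu> p) * norm_XY j D) * norm_XX j (partition_prod \<mu> q)"
    by (intro mult_right_mono norm_XY_compose_left) (simp add: norm_XX_def)
  also have "\<dots> \<le> (\<epsilon>\<^sub>2 s t * norm_XY j D) * \<epsilon>\<^sub>1 s t"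
  proof (intro mult_mono)
    show "norm (partition_prod \<mu> p) \<le> \<epsilon>\<^sub>2 s t"
      using prod_YY[of s u p] \<epsilon>_mono(2)[of s s u t] assms le by simp
    show "norm_XX j (partition_prod \<mu> q) \<le> \<epsilon>\<^sub>1 s t"
      using prod_XX[of v t q] \<epsilon>_mono(1)[of s v t t] assms le by simp
  qed (use \<epsilon>_nonneg assms le in \<open>auto simp: norm_XX_def\<close>)
  finally show ?thesis by (simp add: mult_ac)
qed

section \<open>Removal of points: distance from a partition product to the one-step operator\<close>

text \<open>
  By superadditivity the values of \<open>chi\<close> on overlapping pairs of adjacent intervals add up to at most
  \<open>2 * chi s t\<close>, so one of them is at most the average.
\<close>

lemma exists_small_triple:
  assumes "0 \<le> s" "t \<le> T" "is_partition s t p" "length p \<ge> 3"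
  shows "\<exists>l a b c r. p = l @ a # b # c # r \<and> real (length p - 2) * chi a c \<le> 2 * chi s t"
proof (rule ccontr)
  assume neg: "\<not> ?thesis"
  \<comment> \<open>Each of the \<open>length p - 2\<close> interior points is the middle of one
    pair of adjacent intervals; \<open>m\<close> is the bound on the total of their controls divided
    by this number.\<close>
  define m where "m = 2 * chi s t / real (length p - 2)"
  have large: "m < chi a c" if "p = l @ a # b # c # r" for l a b c r
  proof -
    have "2 * chi s t < real (length p - 2) * chi a c"
      using neg that not_le by blast
    then show ?thesis
      unfolding m_def using assms(4) by (subst divide_less_eq) (auto simp: mult.commute)
  qed
  \<comment> \<open>Pairs starting at every other point do not overlap, so they form two chains;
    \<open>chi a t\<close> and \<open>chi b t\<close> bound their sums, and dropping
    \<open>a\<close> exchanges the chains. Strictness is stated separately because for empty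
    \<open>r\<close> both sides can be 0.\<close>
  have aux: "real (length r) * m \<le> chi a t + chi b t \<and> (r \<noteq> [] \<longrightarrow> real (length r) * m < chi a t + chi b t)"
    if "0 \<le> a" "is_partition a t (a # b # r)"
      "\<And>l x y w r'. a # b # r = l @ x # y # w # r' \<Longrightarrow> m < chi x w" for a b r
    using that
  proof (induction r arbitrary: a b)
    case Nil
    then show ?case using chi_nonneg[of a t] chi_nonneg[of b t] assms(2) by auto
  next
    case (Cons c r)
    have bc: "0 \<le> b" "is_partition b t (b # c # r)" "a \<le> b" "b \<le> c" using Cons.prems by auto
    then have ct: "c \<le> t" using is_partition_le[of c t "c # r"] by simp
    have "real (length r) * m \<le> chi b t + chi c t"
    proof (rule Cons.IH[OF bc(1,2), THEN conjunct1])
      fix l x y w r'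
      assume "b # c # r = l @ x # y # w # r'"
      then have "a # b # c # r = (a # l) @ x # y # w # r'" by simp
      then show "m < chi x w" by (rule Cons.prems(3))
    qed
    moreover have "m < chi a c" using Cons.prems(3)[of "[]" a b c r] by simp
    moreover have "chi a c + chi c t \<le> chi a t"
      using chi_superadditive[of a c t] Cons.prems(1) bc ct assms(2) by simp
    ultimately show ?case by (simp add: algebra_simps)
  qed
  obtain b c r where p: "p = s # b # c # r"
    using assms(3,4) by (cases p rule: remdups_adj.cases; cases "tl (tl p)") (auto simp: is_partition_def)
  have "real (length (c # r)) * m < chi s t + chi b t"
    using aux[of s b "c # r"] assms large unfolding p by auto
  \<comment> \<open>By the choice of \<open>m\<close> the left side of the preceding inequality is
    \<open>2 * chi s t\<close>, so this bound contradicts it.\<close>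
  moreover have "chi b t \<le> chi s t"
    using assms is_partition_le[of b t "b # c # r"] unfolding p by (intro chi_mono) auto
  ultimately show False unfolding m_def p by simp
qed

text \<open>The partial sums are the total costs of successive removals; their convergence for z > 1
  gives one constant for partitions of any length.\<close>

lemma zeta_partial_le: "(\<Sum>n<N. 1 / real (Suc n) powr z) \<le> zeta z"
proof -
  have "summable (\<lambda>n. real (Suc n) powr (- z))"
    using z by (subst summable_Suc_iff) (simp add: summable_real_powr_iff)
  then have "summable (\<lambda>n. 1 / real (Suc n) powr z)"
    by (simp add: powr_minus_divide)
  then show ?thesis unfolding zeta_def by (rule sum_le_suminf) auto
qed

lemma zeta_nonneg: "0 \<le> zeta z"
  using zeta_partial_le[of 0] by simp

text \<open>The induction keeps the partial sum instead of \<open>zeta z\<close>: a removal from a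
  partition with \<open>Suc N\<close> interior points is paid for by the last term, and the first
  \<open>N\<close> terms are left for the remaining partition.\<close>

lemma partition_prod_near_aux:
  assumes "0 \<le> s" "t \<le> T" "is_partition s t p"
  shows "norm_XY j (partition_prod \<mu> p - \<mu> s t) \<le>
    2 powr z * \<epsilon>\<^sub>1 s t * \<epsilon>\<^sub>2 s t * chi s t powr z * (\<Sum>n<length p - 2. 1 / real (Suc n) powr z)"
  using assms(3)
proof (induction "length p" arbitrary: p rule: less_induct)
  case less
  have st: "s \<le> t" using less.prems by (rule is_partition_le)
  consider "length p < 3" | "length p \<ge> 3" by linarith
  then show ?case
  proof cases
    case 1
    then have "p = [s] \<and> s = t \<or> p = [s, t]"
      using less.prems by (cases p rule: remdups_adj.cases) auto
    then have "partition_prod \<mu> p = \<mu> s t"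
      using \<mu>_refl assms by (auto intro!: blinfun_eqI)
    then show ?thesis using 1 by simp
  next
    case 2
    then obtain l a b c r where p: "p = l @ a # b # c # r"
      and small: "real (length p - 2) * chi a c \<le> 2 * chi s t"
      using exists_small_triple[OF assms(1,2) less.prems] by blast
    define q where "q = l @ a # c # r"
    \<comment> \<open>\<open>N\<close> counts the interior points left after \<open>b\<close> is
      removed.\<close>
    define N where "N = length p - 3"
    have N: "length p - 2 = Suc N" "length q - 2 = N" using 2 by (auto simp: p q_def N_def)
    have parts: "is_partition s a (l @ [a])" "a < b" "b < c" "is_partition c t (c # r)"
      using less.prems unfolding p is_partition_append_Cons[of s t l a] by auto
    then have le: "s \<le> a" "c \<le> t" using is_partition_le by blast+
    have q: "is_partition s t q"
      using parts unfolding q_def is_partition_append_Cons[of s t l a] by auto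
    have prod_p: "partition_prod \<mu> p
      = partition_prod \<mu> (l @ [a]) o\<^sub>L (\<mu> a b o\<^sub>L (\<mu> b c o\<^sub>L partition_prod \<mu> (c # r)))"
      unfolding p by (subst partition_prod_append_Cons) simp
    have prod_q: "partition_prod \<mu> q
      = partition_prod \<mu> (l @ [a]) o\<^sub>L (\<mu> a c o\<^sub>L partition_prod \<mu> (c # r))"
      unfolding q_def by (subst partition_prod_append_Cons) simp
    have diff: "partition_prod \<mu> p - partition_prod \<mu> q
      = partition_prod \<mu> (l @ [a]) o\<^sub>L ((\<mu> a b o\<^sub>L \<mu> b c) - \<mu> a c) o\<^sub>L partition_prod \<mu> (c # r)"
      \<comment> \<open>Only the factors over \<open>[a, c]\<close> differ, and there the difference
        is the defect at \<open>b\<close> up to sign.\<close>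
      unfolding prod_p prod_q
      by (intro blinfun_eqI) (simp add: blinfun.bilinear_simps)
    have "norm_XY j (partition_prod \<mu> p - partition_prod \<mu> q)
        \<le> \<epsilon>\<^sub>1 s t * \<epsilon>\<^sub>2 s t * norm_XY j ((\<mu> a b o\<^sub>L \<mu> b c) - \<mu> a c)"
      unfolding diff using parts assms by (intro sandwich_bound) auto
    also have "\<dots> \<le> \<epsilon>\<^sub>1 s t * \<epsilon>\<^sub>2 s t * (2 powr z * chi s t powr z * (1 / real (Suc N) powr z))"
    proof (rule mult_left_mono)
      have "norm_XY j ((\<mu> a b o\<^sub>L \<mu> b c) - \<mu> a c) \<le> chi a c powr z"
        using defect[of a b c] parts le assms by (simp add: norm_XY_minus_commute)
      \<comment> \<open>This is where the choice of the triple enters.\<close>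
      also have "\<dots> \<le> (2 * chi s t / real (Suc N)) powr z"
        using small chi_nonneg[of a c] parts le assms z N(1)
        by (intro powr_mono2) (auto simp: field_simps)
      also have "\<dots> = 2 powr z * chi s t powr z * (1 / real (Suc N) powr z)"
        using chi_nonneg[of s t] st assms by (simp add: powr_divide powr_mult)
      finally show "norm_XY j ((\<mu> a b o\<^sub>L \<mu> b c) - \<mu> a c) \<le> \<dots>" .
    qed (use \<epsilon>_nonneg st assms in auto)
    finally have "norm_XY j (partition_prod \<mu> p - partition_prod \<mu> q)
      \<le> 2 powr z * \<epsilon>\<^sub>1 s t * \<epsilon>\<^sub>2 s t * chi s t powr z * (1 / real (Suc N) powr z)"
      by (simp add: mult_ac)
    moreover have "norm_XY j (partition_prod \<mu> q - \<mu> s t) \<le>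
      2 powr z * \<epsilon>\<^sub>1 s t * \<epsilon>\<^sub>2 s t * chi s t powr z * (\<Sum>n<N. 1 / real (Suc n) powr z)"
      using less.hyps[of q] q N(2) by (simp add: p q_def)
    ultimately show ?thesis
      using norm_XY_diff_triangle[of j "partition_prod \<mu> p" "\<mu> s t" "partition_prod \<mu> q"]
      unfolding N(1) sum.lessThan_Suc distrib_left by linarith
  qed
qed

lemma partition_prod_near:
  assumes "0 \<le> s" "t \<le> T" "is_partition s t p"
  shows "norm_XY j (partition_prod \<mu> p - \<mu> s t) \<le> 2 powr z * zeta z * \<epsilon>\<^sub>1 s t * \<epsilon>\<^sub>2 s t * chi s t powr z"
proof -
  have "0 \<le> 2 powr z * \<epsilon>\<^sub>1 s t * \<epsilon>\<^sub>2 s t * chi s t powr z"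
    using \<epsilon>_nonneg[of s t] is_partition_le assms by auto
  from mult_left_mono[OF zeta_partial_le this, of "length p - 2"]
  show ?thesis using partition_prod_near_aux[OF assms] by (simp add: mult_ac)
qed

section \<open>Comparison of a partition with its refinements\<close>

text \<open>
  The prefix \<open>l\<close> turns the telescoping over the intervals of \<open>p\<close> into an induction on \<open>p\<close>.
\<close>

lemma refinement_bound_aux:
  fixes s\<^sub>0 t :: real
  defines "K \<equiv> 2 powr z * zeta z * \<epsilon>\<^sub>1 s\<^sub>0 t * \<epsilon>\<^sub>2 s\<^sub>0 t"
  assumes "0 \<le> s\<^sub>0" "t \<le> T" "is_partition s\<^sub>0 s l" "is_partition s t p" "is_partition s t q"
    and "set p \<subseteq> set q" and "partition_Max (\<lambda>a b. chi a b powr (z - 1)) p \<le> m"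
  shows "norm_XY j (partition_prod \<mu> l o\<^sub>L (partition_prod \<mu> q - partition_prod \<mu> p))
    \<le> \<epsilon>\<^sub>1 s\<^sub>0 t * \<epsilon>\<^sub>2 s\<^sub>0 t * (K * m) * chi s t"
  using assms(4-)
proof (induction p arbitrary: s l q rule: induct_list012)
  case 1
  then show ?case by simp
next
  case (2 a)
  then have st: "s = t" by simp
  with "2.prems" have "q = [s]"
    using is_partition_le by (cases q rule: remdups_adj.cases) fastforce+
  moreover have "chi s t = 0"
    using ctrl is_partition_le[OF "2.prems"(1)] assms(2,3) st unfolding control_def by auto
  ultimately show ?case by simp
next
  case (3 a b p)
  have ab: "a = s" "s < b" and bp: "is_partition b t (b # p)" using "3.prems" by auto
  have le: "s\<^sub>0 \<le> s" "b \<le> t" using "3.prems"(1) bp is_partition_le by blast+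
  obtain l' where l: "l = l' @ [s]"
    using "3.prems"(1) by (cases l rule: rev_cases) (auto simp: is_partition_def)
  have "b \<in> set q" using "3.prems"(4) by auto
  then obtain q\<^sub>1 q\<^sub>2 where q: "q = q\<^sub>1 @ b # q\<^sub>2" by (auto dest: split_list)
  have q12: "is_partition s b (q\<^sub>1 @ [b])" "is_partition b t (b # q\<^sub>2)"
    using "3.prems"(3) unfolding q is_partition_append_Cons[of s t q\<^sub>1 b] by auto
  have lb: "is_partition s\<^sub>0 b (l @ [b])" "partition_prod \<mu> (l @ [b]) = partition_prod \<mu> l o\<^sub>L \<mu> s b"
  proof -
    show "is_partition s\<^sub>0 b (l @ [b])"
      using "3.prems"(1) ab unfolding l by (simp add: is_partition_append_Cons[of s\<^sub>0 b l' s])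
    show "partition_prod \<mu> (l @ [b]) = partition_prod \<mu> l o\<^sub>L \<mu> s b"
      unfolding l by (simp add: partition_prod_append_Cons[of \<mu> l' s "[b]"] blinfun_eqI)
  qed
  \<comment> \<open>The points of \<open>q\<close> before the cut lie strictly below
    \<open>b\<close>, so all later points of the coarse partition must occur in the right piece of
    \<open>q\<close>.\<close>
  have "set (b # p) \<subseteq> set (b # q\<^sub>2)"
  proof
    fix x assume x: "x \<in> set (b # p)"
    have "sorted_wrt (<) (b # p)" using bp by (simp add: is_partition_def)
    then have "b \<le> x" using x by auto
    moreover have "x \<in> set q" using x "3.prems"(4) by auto
    moreover have "\<forall>y\<in>set q\<^sub>1. y < b"
      using q12(1) by (simp add: is_partition_def sorted_wrt_append)
    ultimately show "x \<in> set (b # q\<^sub>2)" unfolding q by auto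
  qed
  \<comment> \<open>A fixed upper bound \<open>m\<close> passes to the tail unchanged, whereas the
    maximum itself may drop.\<close>
  moreover have m: "chi s b powr (z - 1) \<le> m" "partition_Max (\<lambda>a b. chi a b powr (z - 1)) (b # p) \<le> m"
    using "3.prems"(5) ab by (auto simp: partition_Max_Cons_Cons)
  ultimately have IH: "norm_XY j (partition_prod \<mu> (l @ [b]) o\<^sub>L (partition_prod \<mu> (b # q\<^sub>2) - partition_prod \<mu> (b # p)))
    \<le> \<epsilon>\<^sub>1 s\<^sub>0 t * \<epsilon>\<^sub>2 s\<^sub>0 t * (K * m) * chi b t"
    using lb(1) bp q12(2) by (intro "3.IH"(2))
  have \<epsilon>: "0 \<le> \<epsilon>\<^sub>1 s\<^sub>0 t" "0 \<le> \<epsilon>\<^sub>2 s\<^sub>0 t" using \<epsilon>_nonneg[of s\<^sub>0 t] assms(2,3) le ab by auto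
  then have K: "0 \<le> K" unfolding K_def using zeta_nonneg by simp
  have \<chi>: "0 \<le> chi s b" using chi_nonneg[of s b] ab le assms(2,3) by simp
  have m0: "0 \<le> m" using m(1) powr_ge_zero[of "chi s b" "z - 1"] by linarith
  have "norm_XY j (partition_prod \<mu> l o\<^sub>L (partition_prod \<mu> (q\<^sub>1 @ [b]) - \<mu> s b) o\<^sub>L partition_prod \<mu> (b # q\<^sub>2))
    \<le> \<epsilon>\<^sub>1 s\<^sub>0 t * \<epsilon>\<^sub>2 s\<^sub>0 t * norm_XY j (partition_prod \<mu> (q\<^sub>1 @ [b]) - \<mu> s b)"
    using ab assms(2,3) "3.prems"(1) q12 by (intro sandwich_bound) auto
  also have "\<dots> \<le> \<epsilon>\<^sub>1 s\<^sub>0 t * \<epsilon>\<^sub>2 s\<^sub>0 t * (K * m * chi s b)"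
  proof (rule mult_left_mono)
    have "norm_XY j (partition_prod \<mu> (q\<^sub>1 @ [b]) - \<mu> s b)
        \<le> 2 powr z * zeta z * \<epsilon>\<^sub>1 s b * \<epsilon>\<^sub>2 s b * chi s b powr z"
      using partition_prod_near[OF _ _ q12(1)] ab le assms(2,3) by simp
    also have "\<dots> \<le> K * chi s b powr z"
      unfolding K_def using \<epsilon>_mono[of s\<^sub>0 s b t] \<epsilon>_nonneg[of s b] \<epsilon> zeta_nonneg ab le assms(2,3)
      by (intro mult_right_mono mult_mono) auto
    \<comment> \<open>The power z - 1 is bounded by \<open>m\<close>; the single factor
      \<open>chi s b\<close> is kept to be summed by superadditivity.\<close>
    also have "chi s b powr z = chi s b powr (z - 1) * chi s b"
      using \<chi> z powr_add[of "chi s b" "z - 1" 1] by simp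
    also have "K * (chi s b powr (z - 1) * chi s b) \<le> K * (m * chi s b)"
      using K \<chi> m by (intro mult_left_mono mult_right_mono) auto
    finally show "norm_XY j (partition_prod \<mu> (q\<^sub>1 @ [b]) - \<mu> s b) \<le> K * m * chi s b"
      by (simp add: mult_ac)
  qed (use \<epsilon> in auto)
  finally have first: "norm_XY j (partition_prod \<mu> l o\<^sub>L (partition_prod \<mu> (q\<^sub>1 @ [b]) - \<mu> s b) o\<^sub>L partition_prod \<mu> (b # q\<^sub>2))
    \<le> \<epsilon>\<^sub>1 s\<^sub>0 t * \<epsilon>\<^sub>2 s\<^sub>0 t * (K * m) * chi s b" by (simp add: mult_ac)
  \<comment> \<open>One telescoping step: the refined product over \<open>[s, b]\<close> is
    exchanged for \<open>\<mu> s b\<close>, which then joins the prefix while the tails are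
    compared.\<close>
  have split: "partition_prod \<mu> l o\<^sub>L (partition_prod \<mu> q - partition_prod \<mu> (a # b # p))
    = (partition_prod \<mu> l o\<^sub>L (partition_prod \<mu> (q\<^sub>1 @ [b]) - \<mu> s b) o\<^sub>L partition_prod \<mu> (b # q\<^sub>2))
      + (partition_prod \<mu> (l @ [b]) o\<^sub>L (partition_prod \<mu> (b # q\<^sub>2) - partition_prod \<mu> (b # p)))"
    unfolding q partition_prod_append_Cons[of \<mu> q\<^sub>1 b q\<^sub>2] lb(2) using ab
    by (intro blinfun_eqI) (simp add: blinfun.bilinear_simps)
  have "\<epsilon>\<^sub>1 s\<^sub>0 t * \<epsilon>\<^sub>2 s\<^sub>0 t * (K * m) * (chi s b + chi b t) \<le> \<epsilon>\<^sub>1 s\<^sub>0 t * \<epsilon>\<^sub>2 s\<^sub>0 t * (K * m) * chi s t"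
    using \<epsilon> K m0 chi_superadditive[of s b t] ab le assms(2,3) by (intro mult_left_mono) auto
  then show ?case
    unfolding split using norm_XY_triangle[of j
      "partition_prod \<mu> l o\<^sub>L (partition_prod \<mu> (q\<^sub>1 @ [b]) - \<mu> s b) o\<^sub>L partition_prod \<mu> (b # q\<^sub>2)"
      "partition_prod \<mu> (l @ [b]) o\<^sub>L (partition_prod \<mu> (b # q\<^sub>2) - partition_prod \<mu> (b # p))"]
      first IH unfolding distrib_left by linarith
qed

text \<open>Depends only on the coarser partition, whatever the refinement, and therefore serves as
  a modulus for the Cauchy property.\<close>

definition partition_error :: "real \<Rightarrow> real \<Rightarrow> real list \<Rightarrow> real" where
  "partition_error s t p = 2 powr z * (\<epsilon>\<^sub>1 s t)\<^sup>2 * (\<epsilon>\<^sub>2 s t)\<^sup>2 * zeta z * chi s t *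
     partition_Max (\<lambda>a b. chi a b powr (z - 1)) p"

lemma refinement_bound:
  assumes "0 \<le> s" "t \<le> T" "is_partition s t p" "is_partition s t q" "set p \<subseteq> set q"
  shows "norm_XY j (partition_prod \<mu> p - partition_prod \<mu> q) \<le> partition_error s t p"
proof -
  have "id_blinfun o\<^sub>L A = A" for A :: "'y \<Rightarrow>\<^sub>L 'y" by (rule blinfun_eqI) simp
  then show ?thesis
    \<comment> \<open>The prefix \<open>[s]\<close> is the trivial partition with product the
      identity, and \<open>m\<close> is the maximum itself.\<close>
    using refinement_bound_aux[OF assms(1,2) _ assms(3-5) order_refl, of "[s]"]
    by (simp add: partition_error_def norm_XY_minus_commute power2_eq_square mult_ac)
qed

text \<open>Neither partition need refine the other, so both are compared with their common
  refinement; one error for each is the form that the limit construction asks for.\<close>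

lemma partition_prod_diff_bound:
  assumes "0 \<le> s" "t \<le> T" "is_partition s t p" "is_partition s t q"
  shows "norm_XY j (partition_prod \<mu> p - partition_prod \<mu> q) \<le> partition_error s t p + partition_error s t q"
proof -
  let ?r = "sorted_list_of_set (set p \<union> set q)"
  have r: "is_partition s t ?r" by (rule is_partition_sorted_list_of_set[OF assms(3,4)])
  have "norm_XY j (partition_prod \<mu> p - partition_prod \<mu> ?r) \<le> partition_error s t p"
    "norm_XY j (partition_prod \<mu> q - partition_prod \<mu> ?r) \<le> partition_error s t q"
    using assms r by (auto intro!: refinement_bound)
  then show ?thesis
    using norm_XY_diff_triangle[of j "partition_prod \<mu> p" "partition_prod \<mu> q" "partition_prod \<mu> ?r"]
      norm_XY_minus_commute[of j "partition_prod \<mu> q" "partition_prod \<mu> ?r"] by linarith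
qed

lemma partition_error_tendsto_0:
  assumes "0 \<le> s" "t \<le> T" "\<And>n. is_partition s t (\<pi> n)" "(\<lambda>n. mesh (\<pi> n)) \<longlonglongrightarrow> 0"
  shows "(\<lambda>n. partition_error s t (\<pi> n)) \<longlonglongrightarrow> 0"
proof -
  have "(\<lambda>n. partition_Max (\<lambda>a b. chi a b powr (z - 1)) (\<pi> n)) \<longlonglongrightarrow> 0"
  proof (rule LIMSEQ_I)
    fix e :: real assume e: "e > 0"
    \<comment> \<open>Chosen so that \<open>chi a b < e'\<close> yields
      \<open>chi a b powr (z - 1) \<le> e / 2\<close>.\<close>
    define e' where "e' = (e / 2) powr (1 / (z - 1))"
    have e': "e' > 0" "e' powr (z - 1) = e / 2"
      using e z by (simp_all add: e'_def powr_powr)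
    obtain d where d: "d > 0" "\<And>s t. 0 \<le> s \<Longrightarrow> s \<le> t \<Longrightarrow> t \<le> T \<Longrightarrow> t - s < d \<Longrightarrow> chi s t < e'"
      using chi_uniformly_small[OF e'(1)] by blast
    have small: "partition_Max (\<lambda>a b. chi a b powr (z - 1)) p \<le> e / 2"
      if "0 \<le> s" "is_partition s t p" "mesh p < d" for s p
      using that
    proof (induction p arbitrary: s rule: induct_list012)
      case (3 a b p)
      then have *: "a = s" "s < b" "is_partition b t (b # p)" "b - s < d" "mesh (b # p) < d"
        by (auto simp: mesh_def partition_Max_Cons_Cons)
      then have b: "b \<le> t" using is_partition_le by blast
      have "chi s b powr (z - 1) \<le> e' powr (z - 1)"
        using d(2)[of s b] chi_nonneg[of s b] * b "3.prems"(1) assms(2) z by (intro powr_mono2) auto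
      then show ?case
        using "3.IH"(2)[of b] * "3.prems"(1) e'(2) by (simp add: partition_Max_Cons_Cons)
    qed (use e in auto)
    obtain N where "\<And>n. n \<ge> N \<Longrightarrow> mesh (\<pi> n) < d"
      using LIMSEQ_D[OF assms(4) d(1)] by fastforce
    then show "\<exists>N. \<forall>n\<ge>N. norm (partition_Max (\<lambda>a b. chi a b powr (z - 1)) (\<pi> n) - 0) < e"
      using small[OF assms(1) assms(3)] e by (intro exI[of _ N]) (fastforce simp: partition_Max_nonneg)
  qed
  then show ?thesis unfolding partition_error_def by (rule tendsto_mult_right_zero)
qed

section \<open>The limit operator, its bounds and its uniqueness\<close>

lemma limit_operator_exists:
  assumes "0 \<le> s" "s \<le> t" "t \<le> T"
  shows "\<exists>L. norm L \<le> \<epsilon>\<^sub>2 s t \<and>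
    (\<forall>p. is_partition s t p \<longrightarrow> norm_XY j (partition_prod \<mu> p - L) \<le> partition_error s t p) \<and>
    norm_XY j (L - \<mu> s t) \<le> 2 powr z * zeta z * \<epsilon>\<^sub>1 s t * \<epsilon>\<^sub>2 s t * chi s t powr z"
proof -
  obtain \<pi> where \<pi>: "\<And>n. is_partition s t (\<pi> n)" "(\<lambda>n. mesh (\<pi> n)) \<longlonglongrightarrow> 0"
    using exists_partition_sequence[OF assms(2)] by blast
  have err: "(\<lambda>n. partition_error s t (\<pi> n)) \<longlonglongrightarrow> 0"
    using \<pi> assms by (intro partition_error_tendsto_0) auto
  obtain L where L: "norm L \<le> \<epsilon>\<^sub>2 s t" "(\<lambda>n. norm_XY j (L - partition_prod \<mu> (\<pi> n))) \<longlonglongrightarrow> 0"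
    using norm_XY_limit_exists[OF incl prod_YY[OF assms \<pi>(1)] err partition_prod_diff_bound[OF assms(1,3) \<pi>(1) \<pi>(1)]]
    by blast
  have "norm_XY j (partition_prod \<mu> p - L) \<le> partition_error s t p" if p: "is_partition s t p" for p
  proof (rule LIMSEQ_le_const)
    \<comment> \<open>Along the sequence both the error of \<open>\<pi> n\<close> and its distance
      to \<open>L\<close> vanish, leaving only the error of the fixed partition
      \<open>p\<close>.\<close>
    show "(\<lambda>n. partition_error s t p + (partition_error s t (\<pi> n) + norm_XY j (L - partition_prod \<mu> (\<pi> n))))
        \<longlonglongrightarrow> partition_error s t p"
      using tendsto_add[OF tendsto_const tendsto_add[OF err L(2)], of "partition_error s t p"] by simp
    have "norm_XY j (partition_prod \<mu> p - L)
        \<le> partition_error s t p + (partition_error s t (\<pi> n) + norm_XY j (L - partition_prod \<mu> (\<pi> n)))" for n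
      using norm_XY_diff_triangle[of j "partition_prod \<mu> p" L "partition_prod \<mu> (\<pi> n)"]
        partition_prod_diff_bound[OF assms(1,3) p \<pi>(1)[of n]]
        norm_XY_minus_commute[of j L "partition_prod \<mu> (\<pi> n)"] by linarith
    then show "\<exists>N. \<forall>n\<ge>N. norm_XY j (partition_prod \<mu> p - L)
        \<le> partition_error s t p + (partition_error s t (\<pi> n) + norm_XY j (L - partition_prod \<mu> (\<pi> n)))"
      by blast
  qed
  moreover have "norm_XY j (L - \<mu> s t) \<le> 2 powr z * zeta z * \<epsilon>\<^sub>1 s t * \<epsilon>\<^sub>2 s t * chi s t powr z" (is "_ \<le> ?B")
  proof (rule LIMSEQ_le_const)
    show "(\<lambda>n. norm_XY j (L - partition_prod \<mu> (\<pi> n)) + ?B) \<longlonglongrightarrow> ?B"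
      using tendsto_add[OF L(2) tendsto_const] by simp
    have "norm_XY j (L - \<mu> s t) \<le> norm_XY j (L - partition_prod \<mu> (\<pi> n)) + ?B" for n
      using norm_XY_diff_triangle[of j L "\<mu> s t" "partition_prod \<mu> (\<pi> n)"]
        partition_prod_near[OF assms(1,3) \<pi>(1)[of n]] by linarith
    then show "\<exists>N. \<forall>n\<ge>N. norm_XY j (L - \<mu> s t) \<le> norm_XY j (L - partition_prod \<mu> (\<pi> n)) + ?B"
      by blast
  qed
  ultimately show ?thesis using L(1) by blast
qed

text \<open>The chosen bounds already force convergence along every sequence of vanishing mesh, so
  the limit does not depend on the sequence used to construct it.\<close>

definition limit_operator :: "real \<Rightarrow> real \<Rightarrow> 'y \<Rightarrow>\<^sub>L 'y" where
  "limit_operator s t = (SOME L. norm L \<le> \<epsilon>\<^sub>2 s t \<and>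
    (\<forall>p. is_partition s t p \<longrightarrow> norm_XY j (partition_prod \<mu> p - L) \<le> partition_error s t p) \<and>
    norm_XY j (L - \<mu> s t) \<le> 2 powr z * zeta z * \<epsilon>\<^sub>1 s t * \<epsilon>\<^sub>2 s t * chi s t powr z)"

lemma limit_operator:
  assumes "0 \<le> s" "s \<le> t" "t \<le> T"
  shows "norm (limit_operator s t) \<le> \<epsilon>\<^sub>2 s t"
    and "is_partition s t p \<Longrightarrow> norm_XY j (partition_prod \<mu> p - limit_operator s t) \<le> partition_error s t p"
    and "norm_XY j (limit_operator s t - \<mu> s t) \<le> 2 powr z * zeta z * \<epsilon>\<^sub>1 s t * \<epsilon>\<^sub>2 s t * chi s t powr z"
  using someI_ex[OF limit_operator_exists[OF assms]] unfolding limit_operator_def by blast+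

lemma partition_prod_tendsto_limit_operator:
  assumes "0 \<le> s" "t \<le> T" "\<And>n. is_partition s t (\<pi> n)" "(\<lambda>n. mesh (\<pi> n)) \<longlonglongrightarrow> 0"
  shows "(\<lambda>n. norm_XY j (limit_operator s t - partition_prod \<mu> (\<pi> n))) \<longlonglongrightarrow> 0"
proof (rule tendsto_sandwich[OF _ _ tendsto_const partition_error_tendsto_0[OF assms]])
  have "s \<le> t" using is_partition_le assms(3) by blast
  then show "\<forall>\<^sub>F n in sequentially. norm_XY j (limit_operator s t - partition_prod \<mu> (\<pi> n)) \<le> partition_error s t (\<pi> n)"
    using limit_operator(2)[OF assms(1) _ assms(2) assms(3)] by (simp add: norm_XY_minus_commute)
qed simp

lemma partition_limit_limit_operator: "partition_limit j T \<mu> limit_operator"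
  unfolding partition_limit_def using partition_prod_tendsto_limit_operator by blast

lemma partition_limit_unique:
  assumes "partition_limit j T \<mu> \<phi>" "0 \<le> s" "s \<le> t" "t \<le> T"
  shows "\<phi> s t = limit_operator s t"
proof -
  obtain \<pi> where \<pi>: "\<And>n. is_partition s t (\<pi> n)" "(\<lambda>n. mesh (\<pi> n)) \<longlonglongrightarrow> 0"
    using exists_partition_sequence[OF assms(3)] by blast
  have "(\<lambda>n. norm_XY j (\<phi> s t - partition_prod \<mu> (\<pi> n))) \<longlonglongrightarrow> 0"
    using assms \<pi> unfolding partition_limit_def by blast
  from tendsto_add[OF this partition_prod_tendsto_limit_operator[OF assms(2,4) \<pi>]]
  have lim: "(\<lambda>n. norm_XY j (\<phi> s t - partition_prod \<mu> (\<pi> n))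
      + norm_XY j (limit_operator s t - partition_prod \<mu> (\<pi> n))) \<longlonglongrightarrow> 0" by simp
  have "norm_XY j (\<phi> s t - limit_operator s t) \<le> norm_XY j (\<phi> s t - partition_prod \<mu> (\<pi> n))
      + norm_XY j (limit_operator s t - partition_prod \<mu> (\<pi> n))" for n
    using norm_XY_diff_triangle[of j "\<phi> s t" "limit_operator s t" "partition_prod \<mu> (\<pi> n)"]
    by (simp add: norm_XY_minus_commute)
  then have "norm_XY j (\<phi> s t - limit_operator s t) \<le> 0"
    using LIMSEQ_le_const[OF lim] by blast
  then show ?thesis by (rule eq_of_norm_XY_le_0[OF incl])
qed

text \<open>Joining partitions of \<open>[s, u]\<close> and \<open>[u, t]\<close> multiplies their
  products and takes the larger mesh. It remains to pass to the limit in a composition, which strong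
  convergence allows thanks to the uniform bound on Y.\<close>

lemma limit_operator_compose:
  assumes "0 \<le> s" "s \<le> u" "u \<le> t" "t \<le> T"
  shows "limit_operator s t = limit_operator s u o\<^sub>L limit_operator u t"
proof (rule blinfun_eq_on_banach_inclusion[OF incl])
  fix x
  obtain \<pi> where \<pi>: "\<And>n. is_partition s u (\<pi> n)" "(\<lambda>n. mesh (\<pi> n)) \<longlonglongrightarrow> 0"
    using exists_partition_sequence[OF assms(2)] by blast
  obtain \<rho> where \<rho>: "\<And>n. is_partition u t (\<rho> n)" "(\<lambda>n. mesh (\<rho> n)) \<longlonglongrightarrow> 0"
    using exists_partition_sequence[OF assms(3)] by blast
  \<comment> \<open>Both partitions contain \<open>u\<close>; \<open>butlast\<close> and
    \<open>tl\<close> keep a single copy of it.\<close>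
  define \<sigma> where "\<sigma> n = butlast (\<pi> n) @ u # tl (\<rho> n)" for n
  have eqs: "butlast (\<pi> n) @ [u] = \<pi> n" "u # tl (\<rho> n) = \<rho> n" for n
    using \<pi>(1)[of n] \<rho>(1)[of n] unfolding is_partition_def
    by (metis append_butlast_last_id, metis list.collapse)
  have \<sigma>: "is_partition s t (\<sigma> n)"
    "partition_prod \<mu> (\<sigma> n) = partition_prod \<mu> (\<pi> n) o\<^sub>L partition_prod \<mu> (\<rho> n)"
    "mesh (\<sigma> n) = max (mesh (\<pi> n)) (mesh (\<rho> n))" for n
    using \<pi>(1)[of n] \<rho>(1)[of n] eqs[of n] is_partition_append_Cons[of s t "butlast (\<pi> n)" u "tl (\<rho> n)"]
      partition_prod_append_Cons[of \<mu> "butlast (\<pi> n)" u "tl (\<rho> n)"]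
      partition_Max_append_Cons[of "\<lambda>a b. \<bar>b - a\<bar>" "butlast (\<pi> n)" u "tl (\<rho> n)"]
    by (simp_all add: \<sigma>_def mesh_def)
  have mesh: "(\<lambda>n. mesh (\<sigma> n)) \<longlonglongrightarrow> 0"
    unfolding \<sigma>(3) using tendsto_max[OF \<pi>(2) \<rho>(2)] by simp
  have strong: "(\<lambda>n. blinfun_apply (partition_prod \<mu> (\<pi>' n)) y) \<longlonglongrightarrow> blinfun_apply (limit_operator a b) y"
    if "0 \<le> a" "a \<le> b" "b \<le> T" "\<And>n. is_partition a b (\<pi>' n)" "(\<lambda>n. mesh (\<pi>' n)) \<longlonglongrightarrow> 0" for a b \<pi>' y
    by (rule tendsto_blinfun_apply_of_norm_XY[OF incl prod_YY[OF that(1-4)]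
          partition_prod_tendsto_limit_operator[OF that(1,3-5)]])
  let ?y = "blinfun_apply j x"
  let ?v = "blinfun_apply (limit_operator u t) ?y"
  let ?w = "\<lambda>n. blinfun_apply (partition_prod \<mu> (\<rho> n)) ?y"
  have w: "?w \<longlonglongrightarrow> ?v" using assms \<rho> by (intro strong) auto
  \<comment> \<open>Both factors vary with \<open>n\<close>; the uniform bound on the left one
    permits replacing the inner vector by its limit.\<close>
  have "(\<lambda>n. blinfun_apply (partition_prod \<mu> (\<pi> n)) (?w n - ?v)) \<longlonglongrightarrow> 0"
  proof (rule Lim_null_comparison)
    show "\<forall>\<^sub>F n in sequentially. norm (blinfun_apply (partition_prod \<mu> (\<pi> n)) (?w n - ?v))
        \<le> \<epsilon>\<^sub>2 s u * norm (?w n - ?v)"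
    proof (rule always_eventually, rule allI)
      fix n
      have "norm (partition_prod \<mu> (\<pi> n)) \<le> \<epsilon>\<^sub>2 s u" using prod_YY \<pi>(1) assms by simp
      then show "norm (blinfun_apply (partition_prod \<mu> (\<pi> n)) (?w n - ?v)) \<le> \<epsilon>\<^sub>2 s u * norm (?w n - ?v)"
        by (meson norm_blinfun mult_right_mono norm_ge_zero order_trans)
    qed
    show "(\<lambda>n. \<epsilon>\<^sub>2 s u * norm (?w n - ?v)) \<longlonglongrightarrow> 0"
      using w by (intro tendsto_mult_right_zero tendsto_norm_zero) (simp add: LIM_zero_iff)
  qed
  moreover have "(\<lambda>n. blinfun_apply (partition_prod \<mu> (\<pi> n)) ?v) \<longlonglongrightarrow> blinfun_apply (limit_operator s u) ?v"
    using assms \<pi> by (intro strong) auto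
  ultimately have "(\<lambda>n. blinfun_apply (partition_prod \<mu> (\<pi> n)) (?w n - ?v)
      + blinfun_apply (partition_prod \<mu> (\<pi> n)) ?v) \<longlonglongrightarrow> 0 + blinfun_apply (limit_operator s u) ?v"
    by (rule tendsto_add)
  then have "(\<lambda>n. blinfun_apply (partition_prod \<mu> (\<sigma> n)) ?y)
      \<longlonglongrightarrow> blinfun_apply (limit_operator s u o\<^sub>L limit_operator u t) ?y"
    by (simp add: \<sigma>(2) blinfun.diff_right)
  moreover have "(\<lambda>n. blinfun_apply (partition_prod \<mu> (\<sigma> n)) ?y) \<longlonglongrightarrow> blinfun_apply (limit_operator s t) ?y"
    using assms \<sigma>(1) mesh by (intro strong) auto
  ultimately show "blinfun_apply (limit_operator s t) ?y = blinfun_apply (limit_operator s u o\<^sub>L limit_operator u t) ?y"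
    by (rule LIMSEQ_unique[rotated])
qed

lemma evolution_system_limit_operator: "evolution_system T limit_operator"
proof -
  have "limit_operator s s = id_blinfun" if "0 \<le> s" "s \<le> T" for s
    \<comment> \<open>The trivial partition has product the identity and error 0.\<close>
    using limit_operator(2)[of s s "[s]"] that
    by (intro eq_of_norm_XY_le_0[OF incl]) (simp add: partition_error_def norm_XY_minus_commute)
  then show ?thesis
    unfolding evolution_system_def using limit_operator_compose by blast
qed

section \<open>Strong continuity\<close>

text \<open>The limit operator is known to be close to \<open>\<mu>\<close> only on X, so
  \<open>y\<close> is first approximated by some \<open>j x\<close>, uniformly in
  \<open>(s, t)\<close>; on \<open>j x\<close> the limit operator is compared with
  \<open>\<mu>\<close>, and \<open>\<mu>\<close> with the identity.\<close>

lemma strongly_continuous_limit_operator: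
  assumes "strongly_continuous T \<mu>"
  shows "strongly_continuous T limit_operator"
  unfolding strongly_continuous_def
proof (intro allI impI)
  fix y :: 'y and e :: real assume e: "e > 0"
  show "\<exists>d>0. \<forall>(s, t) \<in> time_simplex T. t - s < d \<longrightarrow> norm (blinfun_apply (limit_operator s t) y - y) < e"
  proof (cases "0 \<le> T")
    case False
    then show ?thesis by (intro exI[of _ 1]) (auto simp: time_simplex_def)
  next
    case True
    \<comment> \<open>The remainder \<open>y - j x\<close> occurs twice, once under the limit
      operator and once alone; the summand 1 accounts for the latter.\<close>
    define E where "E = \<epsilon>\<^sub>2 0 T + 1"
    have E: "E > 0" using \<epsilon>_nonneg[of 0 T] True unfolding E_def by simp
    obtain x where x: "norm (y - blinfun_apply j x) < e / (4 * E)"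
      using banach_inclusion_approx[OF incl, of "e / (4 * E)"] e E by auto
    \<comment> \<open>Collects the constant of the estimate against \<open>\<mu>\<close> over all of
      \<open>[0, T]\<close>, including \<open>norm x\<close>; the added 1 makes it positive, and
      \<open>c\<close> below solves \<open>M * c powr z = e / 4\<close>.\<close>
    define M where "M = 2 powr z * zeta z * \<epsilon>\<^sub>1 0 T * \<epsilon>\<^sub>2 0 T * norm x + 1"
    have M: "M > 0" using \<epsilon>_nonneg[of 0 T] True zeta_nonneg unfolding M_def by (simp add: add_nonneg_pos)
    define c where "c = (e / (4 * M)) powr (1 / z)"
    have c: "c > 0" "c powr z = e / (4 * M)" using e M z by (simp_all add: c_def powr_powr)
    obtain d\<^sub>1 where d\<^sub>1: "d\<^sub>1 > 0" "\<And>s t. 0 \<le> s \<Longrightarrow> s \<le> t \<Longrightarrow> t \<le> T \<Longrightarrow> t - s < d\<^sub>1 \<Longrightarrow> chi s t < c"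
      using chi_uniformly_small[OF c(1)] by blast
    obtain d\<^sub>2 where d\<^sub>2: "d\<^sub>2 > 0" "\<And>s t. (s, t) \<in> time_simplex T \<Longrightarrow> t - s < d\<^sub>2 \<Longrightarrow>
        norm (blinfun_apply (\<mu> s t) (blinfun_apply j x) - blinfun_apply j x) < e / 4"
    proof -
      have "e / 4 > 0" using e by simp
      then obtain d where "d > 0" "\<forall>(s, t) \<in> time_simplex T. t - s < d \<longrightarrow>
          norm (blinfun_apply (\<mu> s t) (blinfun_apply j x) - blinfun_apply j x) < e / 4"
        using assms unfolding strongly_continuous_def by blast
      then show thesis using that[of d] by blast
    qed
    have "norm (blinfun_apply (limit_operator s t) y - y) < e"
      if st: "(s, t) \<in> time_simplex T" "t - s < min d\<^sub>1 d\<^sub>2" for s t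
    proof -
      have st': "0 \<le> s" "s \<le> t" "t \<le> T" using st by (auto simp: time_simplex_def)
      let ?L = "limit_operator s t" and ?r = "y - blinfun_apply j x"
      have "norm (blinfun_apply ?L y - y)
        = norm (blinfun_apply ?L ?r + blinfun_apply (?L - \<mu> s t) (blinfun_apply j x)
          + (blinfun_apply (\<mu> s t) (blinfun_apply j x) - blinfun_apply j x) + (- ?r))"
        by (simp add: blinfun.bilinear_simps)
      also have "\<dots> \<le> norm (blinfun_apply ?L ?r) + norm (blinfun_apply (?L - \<mu> s t) (blinfun_apply j x))
          + norm (blinfun_apply (\<mu> s t) (blinfun_apply j x) - blinfun_apply j x) + norm (- ?r)"
        by (intro order_trans[OF norm_triangle_ineq] add_right_mono order_refl)
      also have "\<dots> < e"
      proof -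
        have "norm ?L \<le> \<epsilon>\<^sub>2 0 T"
          by (rule order_trans[OF limit_operator(1)[OF st'] \<epsilon>_mono(2)[OF order_refl st' order_refl]])
        from mult_right_mono[OF this norm_ge_zero] norm_blinfun[of ?L ?r]
        have "norm (blinfun_apply ?L ?r) \<le> \<epsilon>\<^sub>2 0 T * norm ?r" by (rule order_trans[rotated])
        then have "norm (blinfun_apply ?L ?r) + norm ?r \<le> E * norm ?r"
          unfolding E_def by (simp add: distrib_right)
        also have "\<dots> < E * (e / (4 * E))" using x E by (rule mult_strict_left_mono)
        also have "\<dots> = e / 4" using E by simp
        finally have 1: "norm (blinfun_apply ?L ?r) + norm ?r < e / 4" .
        have "norm (blinfun_apply (?L - \<mu> s t) (blinfun_apply j x)) \<le> norm_XY j (?L - \<mu> s t) * norm x"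
          by (rule norm_XY_apply)
        also have "\<dots> \<le> (2 powr z * zeta z * \<epsilon>\<^sub>1 s t * \<epsilon>\<^sub>2 s t * chi s t powr z) * norm x"
          by (intro mult_right_mono limit_operator(3) st') simp
        also have "\<dots> \<le> (2 powr z * zeta z * \<epsilon>\<^sub>1 0 T * \<epsilon>\<^sub>2 0 T * c powr z) * norm x"
          using \<epsilon>_mono[of 0 s t T] \<epsilon>_nonneg[of s t] \<epsilon>_nonneg[of 0 T] zeta_nonneg st'
            d\<^sub>1(2)[of s t] chi_nonneg[of s t] st(2) z True
          by (intro mult_right_mono mult_mono powr_mono2) auto
        also have "\<dots> \<le> M * c powr z"
          unfolding M_def by (simp add: algebra_simps)
        also have "\<dots> = e / 4" using M c(2) by simp
        finally have 2: "norm (blinfun_apply (?L - \<mu> s t) (blinfun_apply j x)) \<le> e / 4" .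
        \<comment> \<open>Three contributions of at most \<open>e / 4\<close> each stay below
          \<open>e\<close>.\<close>
        show ?thesis using 1 2 d\<^sub>2(2)[OF st(1)] st(2) e unfolding norm_minus_cancel by linarith
      qed
      finally show ?thesis .
    qed
    then show ?thesis using d\<^sub>1(1) d\<^sub>2(1) by (intro exI[of _ "min d\<^sub>1 d\<^sub>2"]) auto
  qed
qed

end

theorem theorem1p1:
  fixes T z :: real
    and j :: "'x::banach \<Rightarrow>\<^sub>L 'y::banach"
    and \<mu> :: "real \<Rightarrow> real \<Rightarrow> ('y \<Rightarrow>\<^sub>L 'y)"
    and \<epsilon>\<^sub>1 \<epsilon>\<^sub>2 chi :: "real \<Rightarrow> real \<Rightarrow> real"
  assumes "T > 0"
    and "banach_inclusion j"
    and "\<And>s t. 0 \<le> s \<Longrightarrow> s \<le> t \<Longrightarrow> t \<le> T \<Longrightarrow> preserves j (\<mu> s t)"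
    and "\<And>s. 0 \<le> s \<Longrightarrow> s \<le> T \<Longrightarrow> \<mu> s s = id_blinfun"
    and "monotone_bound T \<epsilon>\<^sub>1" and "monotone_bound T \<epsilon>\<^sub>2"
    and "\<And>s t p. 0 \<le> s \<Longrightarrow> s \<le> t \<Longrightarrow> t \<le> T \<Longrightarrow> is_partition s t p \<Longrightarrow>
           norm_XX j (partition_prod \<mu> p) \<le> \<epsilon>\<^sub>1 s t"
    and "\<And>s t p. 0 \<le> s \<Longrightarrow> s \<le> t \<Longrightarrow> t \<le> T \<Longrightarrow> is_partition s t p \<Longrightarrow>
           norm (partition_prod \<mu> p) \<le> \<epsilon>\<^sub>2 s t"
    and "control T chi" and "z > 1"
    and "\<And>s u t. 0 \<le> s \<Longrightarrow> s \<le> u \<Longrightarrow> u \<le> t \<Longrightarrow> t \<le> T \<Longrightarrow>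
           norm_XY j (\<mu> s t - (\<mu> s u o\<^sub>L \<mu> u t)) \<le> chi s t powr z"
  shows "\<exists>\<psi> :: real \<Rightarrow> real \<Rightarrow> ('y \<Rightarrow>\<^sub>L 'y).
      evolution_system T \<psi> \<and> partition_limit j T \<mu> \<psi> \<and>
      (\<forall>\<phi>. evolution_system T \<phi> \<and> partition_limit j T \<mu> \<phi> \<longrightarrow>
         (\<forall>(s, t) \<in> time_simplex T. \<phi> s t = \<psi> s t)) \<and>
      (\<forall>(s, t) \<in> time_simplex T. norm (\<psi> s t) \<le> \<epsilon>\<^sub>2 s t) \<and>
      (\<forall>(s, t) \<in> time_simplex T.
         norm_XY j (\<psi> s t - \<mu> s t) \<le> 2 powr z * zeta z * \<epsilon>\<^sub>1 s t * \<epsilon>\<^sub>2 s t * chi s t powr z) \<and>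
      (\<forall>(s, t) \<in> time_simplex T. \<forall>p. is_partition s t p \<longrightarrow>
         norm_XY j (partition_prod \<mu> p - \<psi> s t) \<le>
           2 powr z * (\<epsilon>\<^sub>1 s t)\<^sup>2 * (\<epsilon>\<^sub>2 s t)\<^sup>2 * zeta z * chi s t *
           partition_Max (\<lambda>a b. chi a b powr (z - 1)) p) \<and>
      (strongly_continuous T \<mu> \<longrightarrow> strongly_continuous T \<psi>)"
proof -
  interpret almost_evolution T z j \<mu> \<epsilon>\<^sub>1 \<epsilon>\<^sub>2 chi
    by unfold_locales (fact assms)+
  show ?thesis
  proof (intro exI[of _ limit_operator] conjI)
    show "\<forall>\<phi>. evolution_system T \<phi> \<and> partition_limit j T \<mu> \<phi> \<longrightarrow>
        (\<forall>(s, t) \<in> time_simplex T. \<phi> s t = limit_operator s t)"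
      using partition_limit_unique by (auto simp: time_simplex_def)
    show "\<forall>(s, t) \<in> time_simplex T. \<forall>p. is_partition s t p \<longrightarrow>
        norm_XY j (partition_prod \<mu> p - limit_operator s t) \<le>
          2 powr z * (\<epsilon>\<^sub>1 s t)\<^sup>2 * (\<epsilon>\<^sub>2 s t)\<^sup>2 * zeta z * chi s t *
          partition_Max (\<lambda>a b. chi a b powr (z - 1)) p"
      using limit_operator(2) by (auto simp: time_simplex_def partition_error_def)
  qed (use limit_operator(1,3) evolution_system_limit_operator partition_limit_limit_operator
      strongly_continuous_limit_operator in \<open>auto simp: time_simplex_def\<close>)
qed

end
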